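(* Let $D$ be a finite digraph. Then its line digraph $\overrightarrow{L}D$ is the digraph of a unitary matrix if and only if $D$ is Eulerian or the disjoint union of Eulerian components.
   Context: Throughout, digraphs are finite, may have loops and multiple arcs, and are assumed to have no sources (vertices with no ingoing arcs), no sinks (vertices with no outgoing arcs) and no isolated loopless vertices. The line digraph $\overrightarrow{L}D$ has vertex set $A(D)$, with an arc from $(u,v)$ to $(v',w)$ if and only if $v=v'$. A digraph $E$ on $\{x_1,\dots,x_m\}$ is the digraph of an $m\times m$ matrix $M$ if $(x_i,x_j)$ is an arc exactly when $M_{ij}\neq 0$. A digraph is Eulerian if every vertex has in-degree equal to its out-degree. *)

theory Defs
  imports
    "Graph_Theory.Digraph_Component"
    "Jordan_Normal_Form.Schur_Decomposition"
begin

text \<open>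
  A loop at a vertex is both an ingoing and an outgoing arc of it. The last assumption follows from
  the one on sources; it is kept because it belongs to the usual list of conditions.
\<close>

locale no_source_sink_digraph = fin_digraph G for G :: "('a, 'b) pre_digraph" (structure) +
  assumes no_source: "v \<in> verts G \<Longrightarrow> in_arcs G v \<noteq> {}"
    and no_sink: "v \<in> verts G \<Longrightarrow> out_arcs G v \<noteq> {}"
    and no_isolated_loopless:
      "v \<in> verts G \<Longrightarrow>
        \<not> ((\<forall>u \<in> verts G - {v}. \<not> u \<rightarrow> v \<and> \<not> v \<rightarrow> u) \<and> \<not> v \<rightarrow> v)"

text \<open>
  Vertices are the arcs themselves rather than pairs of end points, so that parallel arcs of
  the digraph give distinct vertices of the line digraph.
\<close>

definition line_digraph :: "('a, 'b) pre_digraph \<Rightarrow> ('b, 'b \<times> 'b) pre_digraph" where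
  "line_digraph D =
    \<lparr> verts = arcs D,
      arcs = {(e, f). e \<in> arcs D \<and> f \<in> arcs D \<and> head D e = tail D f},
      tail = fst, head = snd \<rparr>"

definition eulerian :: "('a, 'b) pre_digraph \<Rightarrow> bool" where
  "eulerian D \<longleftrightarrow> (\<forall>v \<in> verts D. in_degree D v = out_degree D v)"

text \<open>
  The predicate \<open>connected\<close> ignores the orientation of arcs, so these are the weak components.
\<close>

definition components :: "('a, 'b) pre_digraph \<Rightarrow> ('a, 'b) pre_digraph set" where
  "components D = {H. pre_digraph.max_subgraph D connected H}"

definition disjoint_union_of_eulerian_components :: "('a, 'b) pre_digraph \<Rightarrow> bool" where
  "disjoint_union_of_eulerian_components D \<longleftrightarrow>
    (\<exists>S. S \<subseteq> components D \<and> (\<forall>H \<in> S. eulerian H) \<and>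
      pairwise (\<lambda>H H'. verts H \<inter> verts H' = {}) S \<and> D = pre_digraph.Union D S)"

text \<open>The bijection \<open>x\<close> is the labelling of the vertices by the row and column indices.\<close>

definition is_digraph_of_mat :: "('a, 'b) pre_digraph \<Rightarrow> 'c :: zero mat \<Rightarrow> bool" where
  "is_digraph_of_mat E M \<longleftrightarrow>
    (\<exists>m x. M \<in> carrier_mat m m \<and> bij_betw x {..<m} (verts E) \<and>
      (\<forall>i<m. \<forall>j<m. x i \<rightarrow>\<^bsub>E\<^esub> x j \<longleftrightarrow> M $$ (i, j) \<noteq> 0))"

definition unitary_mat :: "complex mat \<Rightarrow> bool" where
  "unitary_mat M \<longleftrightarrow>
    square_mat M \<and> inverts_mat M (mat_adjoint M) \<and> inverts_mat (mat_adjoint M) M"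

end

theory Submission
  imports Defs
begin

text \<open>
  The arcs into a vertex \<open>v\<close> and the arcs out of \<open>v\<close> index a complete bipartite block of the line
  digraph: the rows of its matrix at the in-arcs of \<open>v\<close> are supported on the out-arcs of \<open>v\<close>, and
  the columns at the out-arcs on the in-arcs. Since the rows and columns of a unitary matrix are
  unit vectors, the sum of the squared moduli over the block equals both the in-degree and the
  out-degree of \<open>v\<close>. Conversely, if these degrees agree for every \<open>v\<close>, fill each block with a
  unitary matrix without zero entries. If \<open>d\<close> is the degree and \<open>J\<close> the all-ones matrix, then
  \<open>I + c J\<close> is unitary as soon as \<open>1 + d c\<close> has modulus 1; taking this number to be \<open>\<i>\<close> makes \<open>c\<close>
  non-real, so no entry vanishes.
\<close>

lemma mat_adjoint_carrier:
  "A \<in> carrier_mat n n \<Longrightarrow> mat_adjoint A \<in> carrier_mat n n"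
  by (simp add: mat_adjoint_def mat_of_rows_def)

lemma index_mat_adjoint:
  assumes "A \<in> carrier_mat n n" "i < n" "j < n"
  shows "mat_adjoint A $$ (i, j) = conjugate (A $$ (j, i))"
  using assms by (simp add: mat_adjoint_def mat_of_rows_def)

lemma index_mult_mat_adjoint:
  fixes A :: "complex mat"
  assumes "A \<in> carrier_mat n n" "i < n" "k < n"
  shows "(A * mat_adjoint A) $$ (i, k) = (\<Sum>j<n. A $$ (i, j) * cnj (A $$ (k, j)))"
  using assms mat_adjoint_carrier[OF assms(1)]
  by (auto simp: scalar_prod_def index_mat_adjoint conjugate_complex_def atLeast0LessThan
      intro!: sum.cong)

lemma index_mat_adjoint_mult:
  fixes A :: "complex mat"
  assumes "A \<in> carrier_mat n n" "i < n" "k < n"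
  shows "(mat_adjoint A * A) $$ (i, k) = (\<Sum>j<n. cnj (A $$ (j, i)) * A $$ (j, k))"
  using assms mat_adjoint_carrier[OF assms(1)]
  by (auto simp: scalar_prod_def index_mat_adjoint conjugate_complex_def atLeast0LessThan
      intro!: sum.cong)

text \<open>Orthonormal rows suffice, since a right inverse of a square matrix is also a left
  inverse.\<close>

lemma unitary_matI:
  assumes A: "A \<in> carrier_mat n n"
    and rows: "\<And>i k. i < n \<Longrightarrow> k < n \<Longrightarrow>
      (\<Sum>j<n. A $$ (i, j) * cnj (A $$ (k, j))) = (if i = k then 1 else 0)"
  shows "unitary_mat A"
proof -
  note A' = mat_adjoint_carrier[OF A]
  have "A * mat_adjoint A = 1\<^sub>m n"
    using A A' by (intro eq_matI) (auto simp: index_mult_mat_adjoint rows simp del: index_mult_mat(1))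
  moreover from this have "mat_adjoint A * A = 1\<^sub>m n"
    by (rule mat_mult_left_right_inverse[OF A A'])
  ultimately show ?thesis
    using A A' by (simp add: unitary_mat_def inverts_mat_def)
qed

lemma unitary_mat_row_norm:
  assumes "unitary_mat A" and A: "A \<in> carrier_mat n n" and i: "i < n"
  shows "(\<Sum>j<n. (cmod (A $$ (i, j)))\<^sup>2) = 1"
proof -
  have "complex_of_real (\<Sum>j<n. (cmod (A $$ (i, j)))\<^sup>2) = (A * mat_adjoint A) $$ (i, i)"
    unfolding index_mult_mat_adjoint[OF A i i] of_real_sum by (simp only: complex_norm_square)
  also have "\<dots> = of_real 1"
    using assms by (simp add: unitary_mat_def inverts_mat_def)
  finally show ?thesis by (simp only: of_real_eq_iff)
qed

lemma unitary_mat_col_norm: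
  assumes "unitary_mat A" and A: "A \<in> carrier_mat n n" and i: "i < n"
  shows "(\<Sum>j<n. (cmod (A $$ (j, i)))\<^sup>2) = 1"
proof -
  have "complex_of_real (\<Sum>j<n. (cmod (A $$ (j, i)))\<^sup>2) = (mat_adjoint A * A) $$ (i, i)"
    unfolding index_mat_adjoint_mult[OF A i i] of_real_sum
    by (simp only: complex_norm_square mult.commute)
  also have "\<dots> = of_real 1"
    using assms mat_adjoint_carrier[OF A] by (simp add: unitary_mat_def inverts_mat_def)
  finally show ?thesis by (simp only: of_real_eq_iff)
qed

text \<open>Double counting of the squared moduli: \<open>I\<close> and \<open>J\<close> capture the
  full support of their rows and columns, so each such row and column contributes exactly 1. Zeros
  inside the block do no harm.\<close>

lemma unitary_mat_block_square:
  assumes U: "unitary_mat A" and A: "A \<in> carrier_mat n n"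
    and sub: "I \<subseteq> {..<n}" "J \<subseteq> {..<n}"
    and rows: "\<And>i j. i \<in> I \<Longrightarrow> j < n \<Longrightarrow> j \<notin> J \<Longrightarrow> A $$ (i, j) = 0"
    and cols: "\<And>i j. i < n \<Longrightarrow> j \<in> J \<Longrightarrow> i \<notin> I \<Longrightarrow> A $$ (i, j) = 0"
  shows "card I = card J"
proof -
  let ?s = "\<lambda>i j. (cmod (A $$ (i, j)))\<^sup>2"
  have row: "(\<Sum>j\<in>J. ?s i j) = 1" if "i \<in> I" for i
  proof -
    have "(\<Sum>j\<in>J. ?s i j) = (\<Sum>j<n. ?s i j)"
      using sub rows that by (intro sum.mono_neutral_left) auto
    then show ?thesis using unitary_mat_row_norm[OF U A, of i] sub that by auto
  qed
  have col: "(\<Sum>i\<in>I. ?s i j) = 1" if "j \<in> J" for j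
  proof -
    have "(\<Sum>i\<in>I. ?s i j) = (\<Sum>i<n. ?s i j)"
      using sub cols that by (intro sum.mono_neutral_left) auto
    then show ?thesis using unitary_mat_col_norm[OF U A, of j] sub that by auto
  qed
  have "real (card I) = (\<Sum>i\<in>I. \<Sum>j\<in>J. ?s i j)" using row by simp
  also have "\<dots> = (\<Sum>j\<in>J. \<Sum>i\<in>I. ?s i j)" by (rule sum.swap)
  also have "\<dots> = real (card J)" using col by simp
  finally show ?thesis by simp
qed

lemma verts_line_digraph [simp]: "verts (line_digraph D) = arcs D"
  by (simp add: line_digraph_def)

lemma line_digraph_dominates_iff:
  "e \<rightarrow>\<^bsub>line_digraph D\<^esub> f \<longleftrightarrow> e \<in> arcs D \<and> f \<in> arcs D \<and> head D e = tail D f"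
  by (force simp: line_digraph_def arcs_ends_def arc_to_ends_def)

lemma unitary_line_digraph_imp_eulerian:
  assumes U: "unitary_mat M" and "is_digraph_of_mat (line_digraph D) M"
  shows "eulerian D"
  unfolding eulerian_def
proof
  fix v
  obtain m x where M: "M \<in> carrier_mat m m" and x: "bij_betw x {..<m} (arcs D)"
    and nz: "\<And>i j. i < m \<Longrightarrow> j < m \<Longrightarrow> x i \<rightarrow>\<^bsub>line_digraph D\<^esub> x j \<longleftrightarrow> M $$ (i, j) \<noteq> 0"
    using assms(2) unfolding is_digraph_of_mat_def by auto
  \<comment> \<open>Rows at the arcs into \<open>v\<close> and columns at the arcs out of
    \<open>v\<close>; the index of a loop at \<open>v\<close> lies in both sets.\<close>
  define I where "I = {i \<in> {..<m}. head D (x i) = v}"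
  define J where "J = {j \<in> {..<m}. tail D (x j) = v}"
  have "card I = card J"
  proof (rule unitary_mat_block_square[OF U M])
    show "M $$ (i, j) = 0" if "i \<in> I" "j < m" "j \<notin> J" for i j
      using that nz[of i j] unfolding I_def J_def line_digraph_dominates_iff by auto
    show "M $$ (i, j) = 0" if "i < m" "j \<in> J" "i \<notin> I" for i j
      using that nz[of i j] unfolding I_def J_def line_digraph_dominates_iff by auto
  qed (auto simp: I_def J_def)
  moreover have "bij_betw x I (in_arcs D v)"
    using x by (rule bij_betw_subset) (use x in \<open>auto simp: I_def bij_betw_def in_arcs_def\<close>)
  moreover have "bij_betw x J (out_arcs D v)"
    using x by (rule bij_betw_subset) (use x in \<open>auto simp: J_def bij_betw_def out_arcs_def\<close>)
  ultimately show "in_degree D v = out_degree D v"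
    by (auto simp: in_degree_def out_degree_def dest!: bij_betw_same_card)
qed

text \<open>Orthonormality of the rows of \<open>I + c J\<close> for the block at one vertex, with
  the rows named by the positions \<open>p\<close> and \<open>q\<close> of their identity
  entry.\<close>

lemma sum_perturbed_indicators:
  fixes S :: "'b set"
  assumes S: "finite S" and p: "p \<in> S" and q: "q \<in> S"
    and c: "c = (\<i> - 1) / of_nat (card S)"
  shows "(\<Sum>f\<in>S. ((if p = f then 1 else 0) + c) * cnj ((if q = f then 1 else 0) + c))
    = (if p = q then 1 else 0)"
proof -
  have d: "card S \<noteq> 0" using S p by auto
  have "(\<Sum>f\<in>S. ((if p = f then 1 else 0) + c) * cnj ((if q = f then 1 else 0) + c))
    = (\<Sum>f\<in>S. (if p = f then (if p = q then 1 else 0) else 0) + (if p = f then cnj c else 0)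
        + (if q = f then c else 0) + c * cnj c)"
    by (intro sum.cong) (auto simp: algebra_simps)
  also have "\<dots> = (if p = q then 1 else 0) + (cnj c + c + of_nat (card S) * (c * cnj c))"
    using S p q by (simp add: sum.distrib)
  \<comment> \<open>With \<open>d = card S\<close>, multiplying by \<open>d\<close> gives
    \<open>|1 + d c|^2 - 1\<close>, and \<open>1 + d c = \<i>\<close>.\<close>
  also have "cnj c + c + of_nat (card S) * (c * cnj c) = 0"
    using d unfolding c by (simp add: field_simps)
  finally show ?thesis by simp
qed

text \<open>Matching in-arcs with out-arcs at every vertex tells where the identity entries of each
  block go.\<close>

lemma (in fin_digraph) eulerian_bij_arcs:
  assumes "eulerian G"
  obtains \<phi> where "inj_on \<phi> (arcs G)"
    and "\<And>e. e \<in> arcs G \<Longrightarrow> \<phi> e \<in> out_arcs G (head G e)"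
proof -
  have "\<exists>g. bij_betw g (in_arcs G v) (out_arcs G v)" if "v \<in> verts G" for v
    using assms that
    by (intro finite_same_card_bij) (auto simp: eulerian_def in_degree_def out_degree_def)
  then obtain g where g: "\<And>v. v \<in> verts G \<Longrightarrow> bij_betw (g v) (in_arcs G v) (out_arcs G v)"
    by metis
  show thesis
  proof
    have out: "g (head G e) e \<in> out_arcs G (head G e)" if "e \<in> arcs G" for e
      using bij_betwE[OF g[of "head G e"]] that by auto
    then show "\<And>e. e \<in> arcs G \<Longrightarrow> g (head G e) e \<in> out_arcs G (head G e)" .
    show "inj_on (\<lambda>e. g (head G e) e) (arcs G)"
    proof (rule inj_onI)
      fix e f assume e: "e \<in> arcs G" "f \<in> arcs G" and eq: "g (head G e) e = g (head G f) f"
      \<comment> \<open>The tail of the image of an arc is the head of that arc, so equal images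
        come from one vertex and its single bijection.\<close>
      then have "head G e = head G f" using out[of e] out[of f] by auto
      then show "e = f"
        using e eq bij_betw_imp_inj_on[OF g[of "head G e"]] by (auto dest: inj_onD)
    qed
  qed
qed

lemma (in fin_digraph) eulerian_imp_unitary_line_digraph:
  assumes "eulerian G"
  shows "\<exists>M :: complex mat. unitary_mat M \<and> is_digraph_of_mat (line_digraph G) M"
proof -
  obtain \<phi> where inj: "inj_on \<phi> (arcs G)"
    and out: "\<And>e. e \<in> arcs G \<Longrightarrow> \<phi> e \<in> out_arcs G (head G e)"
    using eulerian_bij_arcs[OF assms] by blast
  \<comment> \<open>The value depends only on the head of \<open>e\<close>, hence is constant on
    each block.\<close>
  define c :: "'b \<Rightarrow> complex" where "c e = (\<i> - 1) / of_nat (out_degree G (head G e))" for e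
  define u where "u e f = (if head G e = tail G f then (if \<phi> e = f then 1 else 0) + c e else 0)"
    for e f
  have u_zero: "u e f \<noteq> 0 \<longleftrightarrow> head G e = tail G f" if "e \<in> arcs G" for e f
  proof -
    \<comment> \<open>The arc \<open>\<phi> e\<close> leaves the head of \<open>e\<close>, so
      \<open>c e\<close> is a genuine quotient. Its imaginary part then keeps both
      \<open>c e\<close> and \<open>1 + c e\<close> away from 0.\<close>
    have "out_degree G (head G e) \<noteq> 0"
      using out[OF that] finite_out_arcs[of "head G e"] unfolding out_degree_def card_eq_0_iff by blast
    then have "c e \<noteq> 0" "Im (c e) \<noteq> 0"
      by (auto simp: c_def complex_eq_iff)
    then show ?thesis by (auto simp: u_def complex_eq_iff)
  qed
  have orth: "(\<Sum>g\<in>arcs G. u e g * cnj (u f g)) = (if e = f then 1 else 0)"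
    if e: "e \<in> arcs G" and f: "f \<in> arcs G" for e f
  proof (cases "head G e = head G f")
    case True
    have "(\<Sum>g\<in>arcs G. u e g * cnj (u f g)) = (\<Sum>g\<in>out_arcs G (head G e). u e g * cnj (u f g))"
      by (intro sum.mono_neutral_right) (auto simp: u_def)
    also have "\<dots> = (\<Sum>g\<in>out_arcs G (head G e).
        ((if \<phi> e = g then 1 else 0) + c e) * cnj ((if \<phi> f = g then 1 else 0) + c e))"
      using True by (intro sum.cong) (auto simp: u_def c_def)
    also have "\<dots> = (if \<phi> e = \<phi> f then 1 else 0)"
      using out[OF e] out[OF f] True
      by (intro sum_perturbed_indicators) (simp_all add: finite_out_arcs c_def out_degree_def)
    finally show ?thesis using inj e f by (auto dest: inj_onD)
  next
    case False
    \<comment> \<open>Rows of different blocks have disjoint supports: no arc \<open>g\<close> has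
      both heads as its tail.\<close>
    then show ?thesis by (auto simp: u_def intro!: sum.neutral)
  qed
  define m where "m = card (arcs G)"
  obtain x where x: "bij_betw x {..<m} (arcs G)"
    using ex_bij_betw_nat_finite[OF finite_arcs] unfolding m_def atLeast0LessThan by blast
  have x_arc: "x i \<in> arcs G" if "i < m" for i
    using bij_betwE[OF x] that by auto
  have x_eq: "x i = x k \<longleftrightarrow> i = k" if "i < m" "k < m" for i k
    using bij_betw_imp_inj_on[OF x] that by (auto dest: inj_onD)
  define M where "M = mat m m (\<lambda>(i, j). u (x i) (x j))"
  have M: "M \<in> carrier_mat m m" by (simp add: M_def)
  have "unitary_mat M"
  proof (rule unitary_matI[OF M])
    fix i k assume ik: "i < m" "k < m"
    have "(\<Sum>j<m. M $$ (i, j) * cnj (M $$ (k, j))) = (\<Sum>j<m. u (x i) (x j) * cnj (u (x k) (x j)))"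
      using ik by (intro sum.cong) (auto simp: M_def)
    also have "\<dots> = (\<Sum>g\<in>arcs G. u (x i) g * cnj (u (x k) g))"
      by (rule sum.reindex_bij_betw[OF x])
    finally show "(\<Sum>j<m. M $$ (i, j) * cnj (M $$ (k, j))) = (if i = k then 1 else 0)"
      using ik by (simp add: orth x_arc x_eq)
  qed
  moreover have "is_digraph_of_mat (line_digraph G) M"
    unfolding is_digraph_of_mat_def
    by (rule exI[of _ m], rule exI[of _ x])
      (use M x in \<open>auto simp: line_digraph_dominates_iff x_arc u_zero M_def\<close>)
  ultimately show ?thesis by blast
qed

text \<open>A vertex lies in only one member of the disjoint union, and that member contains every
  arc at the vertex, so both degrees are already those in the member.\<close>

lemma disjoint_union_of_eulerian_components_imp_eulerian:
  assumes "disjoint_union_of_eulerian_components D"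
  shows "eulerian D"
  unfolding eulerian_def
proof
  fix v assume v: "v \<in> verts D"
  obtain S where S: "S \<subseteq> components D" and eul: "\<And>H. H \<in> S \<Longrightarrow> eulerian H"
    and disj: "pairwise (\<lambda>H H'. verts H \<inter> verts H' = {}) S" and D: "D = pre_digraph.Union D S"
    using assms unfolding disjoint_union_of_eulerian_components_def by blast
  have sub: "subgraph H D" if "H \<in> S" for H
    using S that by (auto simp: components_def intro: pre_digraph.subgraphI_max_subgraph)
  \<comment> \<open>\<open>D\<close> occurs on both sides of its equation, since
    \<open>pre_digraph.Union\<close> takes \<open>tail\<close> and \<open>head\<close> from it;
    hence a single substitution.\<close>
  have verts_D: "verts D = (\<Union>H\<in>S. verts H)" and arcs_D: "arcs D = (\<Union>H\<in>S. arcs H)"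
    by (subst D, simp add: pre_digraph.Union_def)+
  obtain H where H: "H \<in> S" "v \<in> verts H" using v verts_D by auto
  have ends: "head H' = head D" "tail H' = tail D" if "H' \<in> S" for H'
    using sub[OF that] by (auto simp: subgraph_def compatible_def)
  have uniq: "H' = H" if "H' \<in> S" "v \<in> verts H'" for H'
    using disj H that unfolding pairwise_def by blast
  have wf: "head D e \<in> verts H'" "tail D e \<in> verts H'" if "H' \<in> S" "e \<in> arcs H'" for H' e
    using sub[OF that(1)] that
    by (auto simp: subgraph_def wf_digraph_def compatible_def)
  have "in_arcs D v = in_arcs H v"
    using H(1) uniq wf(1) by (auto simp: in_arcs_def arcs_D ends)
  moreover have "out_arcs D v = out_arcs H v"
    using H(1) uniq wf(2) by (auto simp: out_arcs_def arcs_D ends)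
  moreover have "in_degree H v = out_degree H v"
    using eul H by (auto simp: eulerian_def)
  ultimately show "in_degree D v = out_degree D v"
    by (simp add: in_degree_def out_degree_def)
qed

theorem theorem15:
  fixes D :: "('a, 'b) pre_digraph"
  assumes "no_source_sink_digraph D"
  shows "(\<exists>M :: complex mat. unitary_mat M \<and> is_digraph_of_mat (line_digraph D) M) \<longleftrightarrow>
    eulerian D \<or> disjoint_union_of_eulerian_components D"
proof -
  interpret no_source_sink_digraph D by (rule assms)
  show ?thesis
    using unitary_line_digraph_imp_eulerian eulerian_imp_unitary_line_digraph
      disjoint_union_of_eulerian_components_imp_eulerian by blast
qed

end
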